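(* Let $b_0>0$. Consider the set $\mathcal{A}_1$ of admissible pairs $(b,f)$ with $b\in(0,b_0]$ and $f\in H$ such that $D[f]<\infty$, the lift constraint $$a_0(f)=\frac{4}{\pi b}$$ holds, and the moment constraint $$\frac{b^3}{4}\int_0^1\left|\int_\xi^1 f(\eta)\sqrt{1-\eta^2}\,(\eta-\xi)\,d\eta\right|d\xi\le 1$$ holds. Then there exists $(\tilde b,\tilde f)\in\mathcal{A}_1$ such that $$D[\tilde f]=\min_{(b,f)\in\mathcal{A}_1} D[f],$$ i.e. the infimum of $D$ over $\mathcal{A}_1$ is attained. No sign condition on $f$ (equivalently on the circulation $\Gamma(\xi)=f(\xi)\sqrt{1-\xi^2}$) or on the bending moment is imposed.
   Context: All physical constants (air density, freestream speed, total lift, and the moment bound) are normalized to $1$. $H$ denotes the real Hilbert space of even measurable functions $f:(-1,1)\to\mathbb{R}$ with $\int_{-1}^1 f(\xi)^2\sqrt{1-\xi^2}\,d\xi<\infty$, with inner product $(f,g)=\int_{-1}^1 f g\sqrt{1-\xi^2}\,d\xi$. $U_n$ denotes the Chebyshev polynomial of the second kind ($U_0=1$, $U_1=2x$, $U_{n+1}=2xU_n-U_{n-1}$); they satisfy $\int_{-1}^1U_nU_m\sqrt{1-x^2}\,dx=\frac{\pi}{2}\delta_{nm}$. For $f\in H$, set $a_n(f)=\frac{2}{\pi}\int_{-1}^1 f U_n\sqrt{1-\xi^2}\,d\xi$, so $f=\sum_{m\ge0}a_{2m}U_{2m}$ (odd coefficients vanish by evenness). The induced drag is $D[f]=\frac{\pi}{8}\sum_{m\ge0}(2m+1)a_{2m}(f)^2\in[0,\infty]$;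 it corresponds to a wing of span $b$ with circulation $\Gamma(x)=f(2x/b)\sqrt{1-(2x/b)^2}$, $x\in(-b/2,b/2)$, and is independent of $b$. The lift constraint expresses $\int_{-b/2}^{b/2}\Gamma(x)\,dx=1$ and the moment constraint expresses $\int_{-b/2}^{b/2}|M(x)|\,dx\le1$ with bending moment $M(x)=\int_{|x|}^{b/2}\Gamma(y)(y-|x|)\,dy$. *)

theory Defs
  imports "HOL-Analysis.Analysis"
begin

fun chebU :: "nat \<Rightarrow> real \<Rightarrow> real" where
  "chebU 0 x = 1"
| "chebU (Suc 0) x = 2 * x"
| "chebU (Suc (Suc n)) x = 2 * x * chebU (Suc n) x - chebU n x"

definition inH :: "(real \<Rightarrow> real) \<Rightarrow> bool" where
  "inH f \<longleftrightarrow> f \<in> borel_measurable (restrict_space lborel {-1<..<1})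
     \<and> (\<forall>\<xi>\<in>{-1<..<1}. f (-\<xi>) = f \<xi>)
     \<and> (\<integral>\<^sup>+ \<xi>\<in>{-1<..<1}. ennreal ((f \<xi>)\<^sup>2 * sqrt (1 - \<xi>\<^sup>2)) \<partial>lborel) < \<infinity>"

definition coeffA :: "nat \<Rightarrow> (real \<Rightarrow> real) \<Rightarrow> real" where
  "coeffA n f = 2 / pi * (LBINT \<xi>:{-1<..<1}. f \<xi> * chebU n \<xi> * sqrt (1 - \<xi>\<^sup>2))"

definition drag :: "(real \<Rightarrow> real) \<Rightarrow> ennreal" where
  "drag f = ennreal (pi / 8) * (\<Sum>m. ennreal (real (2 * m + 1) * (coeffA (2 * m) f)\<^sup>2))"

definition moment :: "real \<Rightarrow> (real \<Rightarrow> real) \<Rightarrow> ennreal" where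
  "moment b f = ennreal (b ^ 3 / 4) *
     (\<integral>\<^sup>+ \<xi>\<in>{0..1}. ennreal \<bar>LBINT \<eta>:{\<xi>..1}. f \<eta> * sqrt (1 - \<eta>\<^sup>2) * (\<eta> - \<xi>)\<bar> \<partial>lborel)"

definition admissible1 :: "real \<Rightarrow> (real \<times> (real \<Rightarrow> real)) set" where
  "admissible1 b0 = {(b, f). 0 < b \<and> b \<le> b0 \<and> inH f \<and> drag f < \<infinity>
      \<and> coeffA 0 f = 4 / (pi * b) \<and> moment b f \<le> 1}"

end

theory Submission
  imports Defs
begin

text \<open>
  Direct method. Along a minimising sequence the weighted sums of squares of the coefficients are
  bounded, so a subsequence converges coefficientwise; since the weights \<open>2 m + 1\<close> tend to
  infinity, it even converges in \<open>\<ell>\<^sup>2\<close>. By Riesz--Fischer the limiting coefficients belong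
  to an even function, whose drag is at most the infimum, and the lift constraint recovers the
  limiting span from the zeroth coefficient, which stays away from \<open>0\<close> because \<open>b \<le> b0\<close>.
  The bending moment at \<open>\<xi>\<close> is the inner product with \<open>max 0 (\<eta> - \<xi>)\<close>, a continuous function,
  so it is controlled by the \<open>\<ell>\<^sup>2\<close> norm of the coefficients and converges pointwise; Fatou's lemma
  then preserves the moment constraint.
\<close>

section \<open>Square-integrable functions\<close>

definition sq_integrable :: "'a measure \<Rightarrow> ('a \<Rightarrow> real) \<Rightarrow> bool" where
  "sq_integrable M f \<longleftrightarrow> f \<in> borel_measurable M \<and> integrable M (\<lambda>x. (f x)\<^sup>2)"

lemma sq_integrable_measurable: "sq_integrable M f \<Longrightarrow> f \<in> borel_measurable M"
  and sq_integrable_square: "sq_integrable M f \<Longrightarrow> integrable M (\<lambda>x. (f x)\<^sup>2)"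
  by (auto simp: sq_integrable_def)

lemma sq_integrable_iff_nn_integral:
  "sq_integrable M f \<longleftrightarrow>
     f \<in> borel_measurable M \<and> (\<integral>\<^sup>+ x. ennreal ((f x)\<^sup>2) \<partial>M) < \<infinity>"
  by (auto simp: sq_integrable_def integrable_iff_bounded)

lemma sq_integrable_mult_integrable:
  assumes "sq_integrable M f" "sq_integrable M g"
  shows "integrable M (\<lambda>x. f x * g x)"
proof (rule Bochner_Integration.integrable_bound)
  show "integrable M (\<lambda>x. (f x)\<^sup>2 + (g x)\<^sup>2)"
    using assms by (auto simp: sq_integrable_def)
  show "(\<lambda>x. f x * g x) \<in> borel_measurable M"
    using assms by (auto simp: sq_integrable_def)
  have "\<bar>a * b\<bar> \<le> a\<^sup>2 + b\<^sup>2" for a b :: real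
  proof -
    have "2 * (\<bar>a\<bar> * \<bar>b\<bar>) \<le> a\<^sup>2 + b\<^sup>2"
      using sum_squares_bound[of "\<bar>a\<bar>" "\<bar>b\<bar>"] by simp
    moreover have "0 \<le> \<bar>a\<bar> * \<bar>b\<bar>" by simp
    ultimately show ?thesis unfolding abs_mult by linarith
  qed
  then show "AE x in M. norm (f x * g x) \<le> norm ((f x)\<^sup>2 + (g x)\<^sup>2)"
    by auto
qed

lemma sq_integrable_add:
  assumes "sq_integrable M f" "sq_integrable M g"
  shows "sq_integrable M (\<lambda>x. f x + g x)"
proof -
  have "integrable M (\<lambda>x. (f x)\<^sup>2 + (g x)\<^sup>2 + 2 * (f x * g x))"
    using assms sq_integrable_mult_integrable[OF assms] by (auto simp: sq_integrable_def)
  then show ?thesis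
    using assms by (auto simp: sq_integrable_def power2_sum mult.assoc)
qed

lemma sq_integrable_cmult: "sq_integrable M f \<Longrightarrow> sq_integrable M (\<lambda>x. c * f x)"
  by (auto simp: sq_integrable_def power_mult_distrib)

lemma sq_integrable_diff:
  "sq_integrable M f \<Longrightarrow> sq_integrable M g \<Longrightarrow> sq_integrable M (\<lambda>x. f x - g x)"
  using sq_integrable_add[of M f "\<lambda>x. -1 * g x"] sq_integrable_cmult[of M g "-1"] by simp

lemma sq_integrable_sum:
  "(\<And>i. i \<in> I \<Longrightarrow> sq_integrable M (f i)) \<Longrightarrow> sq_integrable M (\<lambda>x. \<Sum>i\<in>I. f i x)"
proof (induction I rule: infinite_finite_induct)
  case (insert i I)
  then show ?case by (auto intro: sq_integrable_add)
qed (auto simp: sq_integrable_def)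

text \<open>The integral of \<open>(f - t g)^2\<close> is the quadratic
  \<open>F - 2 t B + t^2 G\<close> in \<open>t\<close>; being nonnegative for all \<open>t\<close>,
  it satisfies the discriminant condition.\<close>

lemma Cauchy_Schwarz_integral:
  assumes "sq_integrable M f" "sq_integrable M g"
  shows "(LINT x|M. f x * g x)\<^sup>2 \<le> (LINT x|M. (f x)\<^sup>2) * (LINT x|M. (g x)\<^sup>2)"
proof -
  define F G B where "F = (LINT x|M. (f x)\<^sup>2)" and "G = (LINT x|M. (g x)\<^sup>2)"
    and "B = (LINT x|M. f x * g x)"
  note int = sq_integrable_mult_integrable[OF assms] assms[THEN sq_integrable_square]
  have quad: "0 \<le> F - 2 * t * B + t\<^sup>2 * G" for t
  proof -
    have "0 \<le> (LINT x|M. (f x - t * g x)\<^sup>2)"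
      by simp
    also have "\<dots> = (LINT x|M. (f x)\<^sup>2 - 2 * t * (f x * g x) + t\<^sup>2 * (g x)\<^sup>2)"
      by (intro Bochner_Integration.integral_cong) (auto simp: power2_eq_square algebra_simps)
    also have "\<dots> = F - 2 * t * B + t\<^sup>2 * G"
      using int by (simp add: F_def G_def B_def)
    finally show ?thesis .
  qed
  have "0 \<le> F" "0 \<le> G" by (auto simp: F_def G_def)
  have "B\<^sup>2 \<le> F * G"
  proof (cases "G = 0")
    case True
    \<comment> \<open>With \<open>G = 0\<close> the quadratic is affine in \<open>t\<close>; for
      nonzero \<open>B\<close> the chosen \<open>t\<close> would give it the value -1.\<close>
    have "B = 0"
    proof (rule ccontr)
      assume "B \<noteq> 0"
      then show False
        using quad[of "(F + 1) / (2 * B)"] True by simp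
    qed
    then show ?thesis using \<open>0 \<le> F\<close> \<open>0 \<le> G\<close> by simp
  next
    case False
    with \<open>0 \<le> G\<close> have "0 < G" by simp
    \<comment> \<open>At its minimum point \<open>t = B / G\<close> the quadratic has the value
      \<open>F - B^2 / G\<close>.\<close>
    then have "0 \<le> (F - B\<^sup>2 / G) * G"
      using quad[of "B / G"] by (simp add: power2_eq_square field_simps)
    with \<open>0 < G\<close> show ?thesis by (simp add: algebra_simps)
  qed
  then show ?thesis by (simp add: F_def G_def B_def)
qed

section \<open>Completeness of L2 over a finite measure\<close>

lemma (in finite_measure) sq_integrable_imp_integrable:
  "sq_integrable M f \<Longrightarrow> integrable M f"
  using square_integrable_imp_integrable by (auto simp: sq_integrable_def)

lemma (in finite_measure) sq_integrable_bounded: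
  assumes "f \<in> borel_measurable M" "\<And>x. x \<in> space M \<Longrightarrow> \<bar>f x\<bar> \<le> B"
  shows "sq_integrable M f"
  unfolding sq_integrable_def
proof (intro conjI assms integrable_const_bound[where B = "B\<^sup>2"])
  show "AE x in M. norm ((f x)\<^sup>2) \<le> B\<^sup>2"
    using assms(2) by (intro AE_I2) (force simp: abs_le_square_iff[symmetric])
qed (use assms in auto)

text \<open>The limit is chosen as a pointwise limit of the given functions, so that symmetries of these
  functions pass to it.\<close>

lemma (in finite_measure) L2_complete:
  assumes sq: "\<And>n. sq_integrable M (s n)"
    and Cauchy: "\<And>e. e > 0 \<Longrightarrow> \<exists>N. \<forall>i\<ge>N. \<forall>j\<ge>N. (LINT x|M. (s i x - s j x)\<^sup>2) \<le> e"
  obtains r where "sq_integrable M (\<lambda>x. lim (\<lambda>k. s (r k) x))"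
    "(\<lambda>n. LINT x|M. (s n x - lim (\<lambda>k. s (r k) x))\<^sup>2) \<longlonglongrightarrow> 0"
proof -
  have [measurable]: "s n \<in> borel_measurable M" for n
    using sq sq_integrable_measurable by blast
  \<comment> \<open>Cauchy-Schwarz against the constant 1 bounds the L1 distance by the L2 distance,
    as the measure is finite. Being Cauchy in L1 provides a subsequence that is Cauchy almost
    everywhere.\<close>
  have "\<exists>N. \<forall>i\<ge>N. \<forall>j\<ge>N. (LINT x|M. norm (s i x - s j x)) < e" if "e > 0" for e
  proof -
    define m where "m = measure M (space M)"
    have "m \<ge> 0" by (simp add: m_def)
    \<comment> \<open>The summand 1 keeps the denominator positive for a null measure and makes
      \<open>d * m < e^2\<close> strict.\<close>
    define d where "d = e\<^sup>2 / (m + 1)"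
    have "d > 0" using that \<open>m \<ge> 0\<close> by (simp add: d_def)
    then obtain N where N: "\<forall>i\<ge>N. \<forall>j\<ge>N. (LINT x|M. (s i x - s j x)\<^sup>2) \<le> d"
      using Cauchy by blast
    have "(LINT x|M. norm (s i x - s j x)) < e" if ij: "i \<ge> N" "j \<ge> N" for i j
    proof -
      have sq': "sq_integrable M (\<lambda>x. norm (s i x - s j x))"
        using sq_integrable_diff[OF sq sq, of i j] by (auto simp: sq_integrable_def)
      have "(LINT x|M. norm (s i x - s j x) * 1)\<^sup>2
          \<le> (LINT x|M. (norm (s i x - s j x))\<^sup>2) * (LINT x|M. 1\<^sup>2)"
        by (rule Cauchy_Schwarz_integral[OF sq']) (auto simp: sq_integrable_def)
      also have "\<dots> \<le> d * m"
        using N ij by (auto simp: m_def intro!: mult_right_mono)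
      also have "\<dots> < e\<^sup>2"
        using \<open>e > 0\<close> \<open>m \<ge> 0\<close> by (simp add: d_def field_simps)
      finally show ?thesis
        using \<open>e > 0\<close> by (auto intro: power2_less_imp_less)
    qed
    then show ?thesis by blast
  qed
  with sq_integrable_imp_integrable[OF sq] obtain r where r: "strict_mono r"
      "AE x in M. Cauchy (\<lambda>k. s (r k) x)"
    by (rule cauchy_L1_AE_cauchy_subseq) auto
  define u where "u = (\<lambda>x. lim (\<lambda>k. s (r k) x))"
  have [measurable]: "u \<in> borel_measurable M"
    unfolding u_def by (rule borel_measurable_lim_metric) auto
  have conv: "AE x in M. (\<lambda>k. s (r k) x) \<longlonglongrightarrow> u x"
    using r(2) by eventually_elim (auto simp: u_def Cauchy_convergent_iff convergent_LIMSEQ_iff)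
  \<comment> \<open>Fatou's lemma along the subsequence with \<open>n\<close> fixed: the squared
    distance from \<open>s n\<close> to \<open>u\<close> is at most the liminf of those from
    \<open>s n\<close> to \<open>s (r k)\<close>.\<close>
  have small: "\<exists>N. \<forall>n\<ge>N. (\<integral>\<^sup>+ x. ennreal ((s n x - u x)\<^sup>2) \<partial>M) \<le> ennreal e" if "e > 0" for e
  proof -
    obtain N where N: "\<forall>i\<ge>N. \<forall>j\<ge>N. (LINT x|M. (s i x - s j x)\<^sup>2) \<le> e"
      using Cauchy[OF \<open>e > 0\<close>] by blast
    have "(\<integral>\<^sup>+ x. ennreal ((s n x - u x)\<^sup>2) \<partial>M) \<le> ennreal e" if n: "n \<ge> N" for n
    proof -
      have "AE x in M. ennreal ((s n x - u x)\<^sup>2)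
          = liminf (\<lambda>k. ennreal ((s n x - s (r k) x)\<^sup>2))"
        using conv
      proof eventually_elim
        case (elim x)
        then have "(\<lambda>k. ennreal ((s n x - s (r k) x)\<^sup>2)) \<longlonglongrightarrow> ennreal ((s n x - u x)\<^sup>2)"
          by (intro tendsto_ennrealI tendsto_intros)
        then show ?case by (rule lim_imp_Liminf[OF sequentially_bot, symmetric])
      qed
      then have "(\<integral>\<^sup>+ x. ennreal ((s n x - u x)\<^sup>2) \<partial>M)
          = (\<integral>\<^sup>+ x. liminf (\<lambda>k. ennreal ((s n x - s (r k) x)\<^sup>2)) \<partial>M)"
        by (rule nn_integral_cong_AE)
      also have "\<dots> \<le> liminf (\<lambda>k. \<integral>\<^sup>+ x. ennreal ((s n x - s (r k) x)\<^sup>2) \<partial>M)"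
        by (rule nn_integral_liminf) auto
      also have "\<dots> \<le> ennreal e"
      proof (rule Liminf_le[OF sequentially_bot, of _ "ennreal e"])
        show "\<forall>\<^sub>F k in sequentially. (\<integral>\<^sup>+ x. ennreal ((s n x - s (r k) x)\<^sup>2) \<partial>M) \<le> ennreal e"
          using eventually_ge_at_top[of N]
        proof eventually_elim
          case (elim k)
          then have "N \<le> r k" using seq_suble[OF r(1)] order_trans by blast
          moreover have "(\<integral>\<^sup>+ x. ennreal ((s n x - s (r k) x)\<^sup>2) \<partial>M)
              = ennreal (LINT x|M. (s n x - s (r k) x)\<^sup>2)"
            using sq_integrable_square[OF sq_integrable_diff[OF sq sq]]
            by (intro nn_integral_eq_integral) auto
          ultimately show ?case using N n by (auto intro: ennreal_leI)
        qed
      qed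
      finally show ?thesis .
    qed
    then show ?thesis by blast
  qed
  \<comment> \<open>\<open>u\<close> is square integrable as the difference of \<open>s N\<close>
    and \<open>s N - u\<close>.\<close>
  then obtain N where "(\<integral>\<^sup>+ x. ennreal ((s N x - u x)\<^sup>2) \<partial>M) \<le> ennreal 1"
    by (metis order_refl zero_less_one)
  then have "sq_integrable M (\<lambda>x. s N x - u x)"
    unfolding sq_integrable_iff_nn_integral by (auto intro: le_less_trans)
  from sq_integrable_diff[OF sq this, of N] have squ: "sq_integrable M u"
    by simp
  have "(\<lambda>n. LINT x|M. (s n x - u x)\<^sup>2) \<longlonglongrightarrow> 0"
  proof (rule LIMSEQ_I)
    fix e :: real assume "e > 0"
    then obtain N where N: "\<forall>n\<ge>N. (\<integral>\<^sup>+ x. ennreal ((s n x - u x)\<^sup>2) \<partial>M) \<le> ennreal (e/2)"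
      using small[of "e/2"] by auto
    have "(LINT x|M. (s n x - u x)\<^sup>2) \<le> e / 2" if "n \<ge> N" for n
    proof -
      have "ennreal (LINT x|M. (s n x - u x)\<^sup>2) = (\<integral>\<^sup>+ x. ennreal ((s n x - u x)\<^sup>2) \<partial>M)"
        using sq_integrable_square[OF sq_integrable_diff[OF sq squ]]
        by (intro nn_integral_eq_integral[symmetric]) auto
      also have "\<dots> \<le> ennreal (e / 2)" using N that by blast
      finally show ?thesis using \<open>e > 0\<close> by simp
    qed
    then show "\<exists>N. \<forall>n\<ge>N. norm ((LINT x|M. (s n x - u x)\<^sup>2) - 0) < e"
      using \<open>e > 0\<close> by (intro exI[of _ N]) (fastforce simp: abs_of_nonneg)
  qed
  with squ show thesis by (intro that[of r]) (auto simp: u_def)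
qed

section \<open>Chebyshev polynomials and their weighted measure\<close>

lemma chebU_continuous: "continuous_on S (chebU n)"
  by (induction n rule: induct_nat_012) (auto intro!: continuous_intros simp: fun_eq_iff[symmetric])

lemma chebU_measurable [measurable]: "chebU n \<in> borel_measurable borel"
  by (intro borel_measurable_continuous_onI chebU_continuous)

lemma chebU_minus: "chebU n (- x) = (-1) ^ n * chebU n x"
  by (induction n x rule: chebU.induct) (auto simp: algebra_simps)

text \<open>Multiplied by \<open>sin t\<close>, the recurrence becomes
  \<open>sin((n+3)t) = 2 cos t sin((n+2)t) - sin((n+1)t)\<close>. The product form remains valid
  where \<open>sin t = 0\<close>.\<close>

lemma chebU_cos: "chebU n (cos t) * sin t = sin (real (n + 1) * t)"
proof (induction n rule: induct_nat_012)
  case (ge2 n)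
  have "chebU (Suc (Suc n)) (cos t) * sin t
      = 2 * cos t * sin (real (Suc n + 1) * t) - sin (real (n + 1) * t)"
    using ge2 by (simp add: algebra_simps)
  also have "\<dots> = sin (real (Suc (Suc n) + 1) * t)"
    using sin_times_cos[of "real (Suc n + 1) * t" t] by (simp add: algebra_simps)
  finally show ?case .
qed (auto simp: sin_double)

text \<open>The three-term recurrence solved for the product, with the convention that U at index -1
  is 0; the case \<open>n = 0\<close> is separate because \<open>n - 1\<close> would truncate to
  0.\<close>

lemma chebU_mult_x:
  "x * chebU n x = (chebU (Suc n) x + (if n = 0 then 0 else chebU (n - 1) x)) / 2"
  by (cases n) auto

text \<open>The weight is moved into the measure, so that H becomes the even functions in the
  ordinary L2 space of a finite measure.\<close>

definition cheb_measure :: "real measure" where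
  "cheb_measure = density (restrict_space lborel {-1<..<1}) (\<lambda>x. ennreal (sqrt (1 - x\<^sup>2)))"

lemma space_cheb_measure [simp]: "space cheb_measure = {-1<..<1}"
  and sets_cheb_measure: "sets cheb_measure = sets (restrict_space lborel {-1<..<1})"
  by (auto simp: cheb_measure_def space_restrict_space)

lemma measurable_cheb_measure:
  "borel_measurable cheb_measure = borel_measurable (restrict_space lborel {-1<..<1})"
  by (intro measurable_cong_sets sets_cheb_measure refl)

lemma borel_measurable_cheb_measure:
  "f \<in> borel_measurable borel \<Longrightarrow> f \<in> borel_measurable cheb_measure"
  unfolding measurable_cheb_measure by (simp add: measurable_restrict_space1)

lemma AE_sqrt_nonneg: "AE x in restrict_space lborel {-1<..<1}. 0 \<le> sqrt (1 - (x::real)\<^sup>2)"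
  by (auto simp: AE_restrict_space_iff abs_square_le_1)

lemma integral_cheb_measure:
  assumes "f \<in> borel_measurable cheb_measure"
  shows "(LINT x|cheb_measure. f x) = (LBINT x:{-1<..<1}. f x * sqrt (1 - x\<^sup>2))"
  using assms unfolding measurable_cheb_measure
  unfolding cheb_measure_def
  by (subst integral_density[OF _ _ AE_sqrt_nonneg])
     (auto simp: integral_restrict_space set_lebesgue_integral_def mult.commute
        measurable_restrict_space1)

lemma nn_integral_cheb_measure:
  assumes "f \<in> borel_measurable cheb_measure" "\<And>x. 0 \<le> f x"
  shows "(\<integral>\<^sup>+ x. ennreal (f x) \<partial>cheb_measure)
    = (\<integral>\<^sup>+ x\<in>{-1<..<1}. ennreal (f x * sqrt (1 - x\<^sup>2)) \<partial>lborel)"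
  using assms unfolding measurable_cheb_measure
  unfolding cheb_measure_def
  by (subst nn_integral_density)
     (auto simp: nn_integral_restrict_space mult.commute measurable_restrict_space1 
       ennreal_mult'' abs_square_le_1 intro!: nn_integral_cong split: split_indicator)

text \<open>Substituting \<open>x = cos t\<close> turns the integral into that of
  \<open>sin((n+1)t) sin((m+1)t)\<close> over \<open>[0, pi]\<close>; the substitution is carried
  out through the antiderivative \<open>G (arccos x)\<close>.\<close>

lemma LBINT_chebU_mult:
  "(LBINT x:{-1<..<1}. (chebU n x * chebU m x) * sqrt (1 - x\<^sup>2)) = (if n = m then pi / 2 else 0)"
proof -
  define f where "f = (\<lambda>x. (chebU n x * chebU m x) * sqrt (1 - x\<^sup>2))"
  \<comment> \<open>An antiderivative of minus the product of the two sines; the sign cancels that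
    of the derivative of \<open>arccos\<close>.\<close>
  define G where "G = (\<lambda>t. if n = m
      then sin (2 * real (n + 1) * t) / (4 * real (n + 1)) - t / 2
      else sin (real (n + m + 2) * t) / (2 * real (n + m + 2))
         - sin ((real n - real m) * t) / (2 * (real n - real m)))"
  have G': "(G has_real_derivative - (sin (real (n + 1) * t) * sin (real (m + 1) * t))) (at t)" for t
  proof (cases "n = m")
    case True
    define k where "k = real (n + 1)"
    have "k > 0" by (simp add: k_def)
    then have "((\<lambda>t. sin (2 * k * t) / (4 * k) - t / 2) has_real_derivative (cos (2 * k * t) - 1) / 2) (at t)"
      by (auto intro!: derivative_eq_intros simp: field_simps)
    moreover have "(cos (2 * k * t) - 1) / 2 = - (sin (k * t) * sin (k * t))"
      using cos_double_sin[of "k * t"] by (simp add: power2_eq_square mult.assoc)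
    ultimately show ?thesis
      using True by (simp add: G_def k_def)
  next
    case False
    have "sin (real (n + 1) * t) * sin (real (m + 1) * t)
        = (cos ((real n - real m) * t) - cos (real (n + m + 2) * t)) / 2"
      using sin_times_sin[of "real (n + 1) * t" "real (m + 1) * t"]
      by (simp add: algebra_simps)
    moreover have "((\<lambda>t. sin (k * t) / (2 * k) - sin (l * t) / (2 * l)) has_real_derivative
        (cos (k * t) - cos (l * t)) / 2) (at t)" if "k \<noteq> 0" "l \<noteq> 0" for k l
      using that by (auto intro!: derivative_eq_intros simp: field_simps)
    from this[of "real (n + m + 2)" "real n - real m"] have "(G has_real_derivative
        (cos (real (n + m + 2) * t) - cos ((real n - real m) * t)) / 2) (at t)"
      unfolding G_def using False by simp
    ultimately show ?thesis by (simp add: diff_divide_distrib)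
  qed
  have contf: "continuous_on {-1..1} f"
    unfolding f_def by (intro continuous_intros chebU_continuous)
  \<comment> \<open>Differentiability is only asked in the interior: \<open>arccos\<close> is
    continuous on the closed interval but its derivative blows up at the endpoints.\<close>
  have "(f has_integral (G (arccos 1) - G (arccos (-1)))) {-1..1}"
  proof (rule fundamental_theorem_of_calculus_interior)
    have "continuous_on UNIV G"
      using G' by (intro continuous_at_imp_continuous_on) (auto intro: DERIV_isCont)
    then show "continuous_on {-1..1} (\<lambda>x. G (arccos x))"
      by (rule continuous_on_compose2) (auto intro!: continuous_intros)
    fix x :: real assume x: "x \<in> {-1<..<1}"
    define t where "t = arccos x"
    have t: "cos t = x" "sin t = sqrt (1 - x\<^sup>2)"
      using x by (auto simp: t_def sin_arccos)
    have pos: "0 < sqrt (1 - x\<^sup>2)"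
      using x by (auto simp: abs_square_less_1 abs_less_iff)
    have "f x * sin t = (chebU n (cos t) * sin t) * (chebU m (cos t) * sin t)"
      by (simp add: f_def t)
    also have "\<dots> = sin (real (n + 1) * t) * sin (real (m + 1) * t)"
      by (simp only: chebU_cos)
    finally have "- (sin (real (n + 1) * t) * sin (real (m + 1) * t))
        * inverse (- sqrt (1 - x\<^sup>2)) = f x"
      using pos by (simp add: t field_simps)
    moreover have "((\<lambda>x. G (arccos x)) has_real_derivative
        (- (sin (real (n + 1) * t) * sin (real (m + 1) * t)) * inverse (- sqrt (1 - x\<^sup>2)))) (at x)"
      unfolding t_def by (rule DERIV_chain2[OF G' DERIV_arccos]) (use x in auto)
    ultimately show "((\<lambda>x. G (arccos x)) has_vector_derivative f x) (at x)"
      by (simp add: has_real_derivative_iff_has_vector_derivative)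
  qed simp
  moreover have "G 0 - G pi = (if n = m then pi / 2 else 0)"
  proof -
    have "sin (2 * real (n + 1) * pi) = 0"
      using sin_npi[of "2 * (n + 1)"] by simp
    moreover have "sin (real (n + m + 2) * pi) = 0"
      by (rule sin_npi)
    moreover have "sin ((real n - real m) * pi) = 0"
      using sin_npi_int[of "int n - int m"] by (simp add: mult.commute)
    ultimately show ?thesis by (auto simp: G_def simp del: of_nat_add)
  qed
  ultimately have "integral {-1..1} f = (if n = m then pi / 2 else 0)"
    by (simp add: integral_unique)
  moreover have "(LBINT x:{-1..1}. f x) = integral {-1..1} f"
    using borel_integrable_compact[OF compact_Icc contf]
    by (intro set_borel_integral_eq_integral) (simp add: set_integrable_def indicator_scaleR_eq_if)
  moreover have "(LBINT x:{-1<..<1}. f x) = (LBINT x:{-1..1}. f x)"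
  proof -
    have "AE x in lborel. x \<noteq> (-1::real) \<and> x \<noteq> 1"
      using AE_lborel_singleton[of "-1::real"] AE_lborel_singleton[of "1::real"] by eventually_elim auto
    then show ?thesis
      unfolding set_lebesgue_integral_def f_def
      by (intro integral_cong_AE) (auto split: split_indicator elim!: eventually_mono)
  qed
  ultimately show ?thesis by (simp add: f_def)
qed

lemma integral_chebU_mult:
  "(LINT x|cheb_measure. chebU n x * chebU m x) = (if n = m then pi / 2 else 0)"
  by (subst integral_cheb_measure) (auto simp: LBINT_chebU_mult borel_measurable_cheb_measure)

interpretation cheb: finite_measure cheb_measure
proof
  have "emeasure cheb_measure (space cheb_measure)
      = (\<integral>\<^sup>+ x. ennreal 1 \<partial>cheb_measure)"
    by simp
  also have "\<dots> = (\<integral>\<^sup>+ x\<in>{-1<..<1}. ennreal (1 * sqrt (1 - x\<^sup>2)) \<partial>lborel)"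
    by (rule nn_integral_cheb_measure) auto
  also have "\<dots> \<le> (\<integral>\<^sup>+ x. indicator {-1<..<1::real} x \<partial>lborel)"
    by (intro nn_integral_mono) (auto split: split_indicator)
  also have "\<dots> < \<infinity>" by simp
  finally show "emeasure cheb_measure (space cheb_measure) \<noteq> \<infinity>" by simp
qed

lemma measure_cheb_measure: "measure cheb_measure {-1<..<1} = pi / 2"
  using integral_chebU_mult[of 0 0] by simp

lemma sq_integrable_cheb_continuous:
  assumes "continuous_on {-1..1} f"
  shows "sq_integrable cheb_measure f"
proof -
  have "bounded (f ` {-1..1})"
    using assms by (intro compact_imp_bounded compact_continuous_image) auto
  then obtain B where B: "\<forall>x\<in>{-1..1}. \<bar>f x\<bar> \<le> B"
    by (auto simp: bounded_iff)
  have "f \<in> borel_measurable (restrict_space borel {-1<..<1})"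
    by (intro borel_measurable_continuous_on_restrict continuous_on_subset[OF assms]) auto
  then have "f \<in> borel_measurable cheb_measure"
    unfolding measurable_cheb_measure 
    by (simp cong: measurable_cong_sets add: sets_restrict_space)
  then show ?thesis
    using B by (intro cheb.sq_integrable_bounded[of _ B]) auto
qed

lemma sq_integrable_chebU: "sq_integrable cheb_measure (chebU n)"
  by (intro sq_integrable_cheb_continuous chebU_continuous)

section \<open>The space H and its coefficients in terms of the weighted measure\<close>

lemma inH_iff:
  "inH f \<longleftrightarrow> sq_integrable cheb_measure f \<and> (\<forall>x\<in>{-1<..<1}. f (- x) = f x)"
proof (cases "f \<in> borel_measurable cheb_measure")
  case True
  then show ?thesis
    unfolding inH_def sq_integrable_iff_nn_integral
    by (subst nn_integral_cheb_measure) (auto simp flip: measurable_cheb_measure)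
qed (auto simp: inH_def sq_integrable_def measurable_cheb_measure)

lemma coeffA_eq:
  "sq_integrable cheb_measure f \<Longrightarrow> coeffA n f = 2 / pi * (LINT x|cheb_measure. f x * chebU n x)"
  unfolding coeffA_def
  by (subst integral_cheb_measure)
     (auto intro!: borel_measurable_integrable sq_integrable_mult_integrable sq_integrable_chebU)

lemma coeffA_diff:
  assumes "sq_integrable cheb_measure f" "sq_integrable cheb_measure g"
  shows "coeffA n (\<lambda>x. f x - g x) = coeffA n f - coeffA n g"
  using assms
  by (simp add: coeffA_eq sq_integrable_diff left_diff_distrib right_diff_distrib
      sq_integrable_mult_integrable sq_integrable_chebU)

text \<open>Reflection at 0 changes the sign of the integrand, as \<open>f\<close> is even and
  \<open>chebU n\<close> is odd, so the integral equals its own negative.\<close>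

lemma coeffA_odd_eq_0:
  assumes "inH f" "odd n"
  shows "coeffA n f = 0"
proof -
  have "(LBINT x:{-1<..<1}. f x * chebU n x * sqrt (1 - x\<^sup>2))
      = (LBINT x. indicator {-1<..<1} (0 + -1 * x) *\<^sub>R
          (f (0 + -1 * x) * chebU n (0 + -1 * x) * sqrt (1 - (0 + -1 * x)\<^sup>2)))"
    unfolding set_lebesgue_integral_def
    by (subst lborel_integral_real_affine[where c = "-1" and t = 0]) auto
  also have "\<dots> = (LBINT x. - (indicator {-1<..<1} x *\<^sub>R (f x * chebU n x * sqrt (1 - x\<^sup>2))))"
    using assms
    by (intro Bochner_Integration.integral_cong) (auto simp: inH_def chebU_minus split: split_indicator)
  also have "\<dots> = - (LBINT x:{-1<..<1}. f x * chebU n x * sqrt (1 - x\<^sup>2))"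
    unfolding set_lebesgue_integral_def by simp
  finally show ?thesis by (simp add: coeffA_def)
qed

section \<open>Coefficient estimates and the Riesz--Fischer theorem\<close>

definition cheb_span :: "(real \<Rightarrow> real) \<Rightarrow> bool" where
  "cheb_span p \<longleftrightarrow> (\<exists>N d. p = (\<lambda>x. \<Sum>n<N. d n * chebU n x))"

lemma cheb_spanI: "p = (\<lambda>x. \<Sum>n<N. d n * chebU n x) \<Longrightarrow> cheb_span p"
  unfolding cheb_span_def by (intro exI)

lemma cheb_span_chebU: "cheb_span (chebU n)"
  unfolding cheb_span_def
  by (intro exI[of _ "Suc n"] exI[of _ "\<lambda>m. if m = n then 1 else 0"]) (auto simp: fun_eq_iff)

lemma cheb_span_cmult:
  assumes "cheb_span p"
  shows "cheb_span (\<lambda>x. c * p x)"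
proof -
  obtain N d where "p = (\<lambda>x. \<Sum>n<N. d n * chebU n x)"
    using assms by (auto simp: cheb_span_def)
  then have "(\<lambda>x. c * p x) = (\<lambda>x. \<Sum>n<N. (c * d n) * chebU n x)"
    by (simp add: sum_distrib_left mult.assoc)
  then show ?thesis by (rule cheb_spanI)
qed

lemma cheb_span_add:
  assumes "cheb_span p" "cheb_span q"
  shows "cheb_span (\<lambda>x. p x + q x)"
proof -
  obtain N d M e where p: "p = (\<lambda>x. \<Sum>n<N. d n * chebU n x)"
    and q: "q = (\<lambda>x. \<Sum>n<M. e n * chebU n x)"
    using assms by (auto simp: cheb_span_def)
  \<comment> \<open>Zero coefficients bring both sums to the common length
    \<open>max N M\<close>.\<close>
  have pad: "(\<Sum>n<N. d n * chebU n x) = (\<Sum>n<K. (if n < N then d n else 0) * chebU n x)"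
    if "N \<le> K" for N K and d :: "nat \<Rightarrow> real" and x
    using that by (intro sum.mono_neutral_cong_left) auto
  have "(\<lambda>x. p x + q x) = (\<lambda>x. \<Sum>n<max N M.
      ((if n < N then d n else 0) + (if n < M then e n else 0)) * chebU n x)"
    unfolding p q
    by (simp add: pad[of N "max N M"] pad[of M "max N M"] sum.distrib distrib_right)
  then show ?thesis by (rule cheb_spanI)
qed

lemma cheb_span_0: "cheb_span (\<lambda>x. 0)"
  unfolding cheb_span_def by (intro exI[of _ 0]) auto

lemma cheb_span_sum:
  "(\<And>i. i \<in> I \<Longrightarrow> cheb_span (p i)) \<Longrightarrow> cheb_span (\<lambda>x. \<Sum>i\<in>I. p i x)"
  by (induction I rule: infinite_finite_induct) (auto intro: cheb_span_add cheb_span_0)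

lemma cheb_span_mult_x:
  assumes "cheb_span p"
  shows "cheb_span (\<lambda>x. x * p x)"
proof -
  obtain N d where "p = (\<lambda>x. \<Sum>n<N. d n * chebU n x)"
    using assms by (auto simp: cheb_span_def)
  moreover have "x * (d n * chebU n x)
      = d n * (1 / 2 * (chebU (Suc n) x + (if n = 0 then 0 else chebU (n - 1) x)))" for n x
    using chebU_mult_x[of x n] by (simp only: mult.left_commute[of x])
  ultimately have "(\<lambda>x. x * p x) = (\<lambda>x. \<Sum>n<N. d n *
      (1 / 2 * (chebU (Suc n) x + (if n = 0 then 0 else chebU (n - 1) x))))"
    by (simp only: sum_distrib_left)
  moreover have "cheb_span (\<lambda>x. if n = 0 then 0 else chebU (n - 1) x)" for n
    by (cases "n = 0") (auto intro: cheb_span_0 cheb_span_chebU)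
  ultimately show ?thesis
    by (simp only:) (intro cheb_span_sum cheb_span_cmult cheb_span_add cheb_span_chebU)
qed

text \<open>Monomials arise from \<open>chebU 0\<close> by repeated multiplication by
  \<open>x\<close>, under which the span is closed thanks to the recurrence.\<close>

lemma cheb_span_polynomial:
  assumes "real_polynomial_function p"
  shows "cheb_span p"
proof -
  have "cheb_span (\<lambda>x. x ^ i)" for i
  proof (induction i)
    case 0
    have "chebU 0 = (\<lambda>x. 1)" by (simp add: fun_eq_iff)
    then show ?case using cheb_span_chebU[of 0] by simp
  next
    case (Suc i)
    then show ?case using cheb_span_mult_x[of "\<lambda>x. x ^ i"] by simp
  qed
  then show ?thesis
    using assms unfolding real_polynomial_function_iff_sum
    by (auto intro!: cheb_span_sum cheb_span_cmult)
qed

section \<open>Inner products with finite Chebyshev sums\<close>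

lemma sq_integrable_cheb_sum: "sq_integrable cheb_measure (\<lambda>x. \<Sum>n\<in>I. d n * chebU n x)"
  by (intro sq_integrable_sum sq_integrable_cmult sq_integrable_chebU)

text \<open>Linearity; the factor \<open>pi / 2\<close> inverts the normalisation
  \<open>2 / pi\<close> in \<open>coeffA\<close>.\<close>

lemma integral_mult_cheb_sum:
  assumes f: "sq_integrable cheb_measure f"
  shows "(LINT x|cheb_measure. f x * (\<Sum>n\<in>I. d n * chebU n x)) = pi / 2 * (\<Sum>n\<in>I. d n * coeffA n f)"
proof -
  have "(LINT x|cheb_measure. f x * (\<Sum>n\<in>I. d n * chebU n x))
      = (LINT x|cheb_measure. (\<Sum>n\<in>I. d n * (f x * chebU n x)))"
    by (simp only: sum_distrib_left mult.left_commute)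
  also have "\<dots> = (\<Sum>n\<in>I. d n * (LINT x|cheb_measure. f x * chebU n x))"
    using sq_integrable_mult_integrable[OF f sq_integrable_chebU] by simp
  also have "\<dots> = pi / 2 * (\<Sum>n\<in>I. d n * coeffA n f)"
    unfolding coeffA_eq[OF f] sum_distrib_left by (intro sum.cong refl) simp
  finally show ?thesis .
qed

lemma coeffA_chebU: "coeffA n (chebU m) = (if n = m then 1 else 0)"
  by (simp add: coeffA_eq[OF sq_integrable_chebU] integral_chebU_mult)

lemma coeffA_cheb_sum:
  assumes "finite I"
  shows "coeffA n (\<lambda>x. \<Sum>m\<in>I. d m * chebU m x) = (if n \<in> I then d n else 0)"
proof -
  have "coeffA n (\<lambda>x. \<Sum>m\<in>I. d m * chebU m x)
      = 2 / pi * (LINT x|cheb_measure. chebU n x * (\<Sum>m\<in>I. d m * chebU m x))"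
    unfolding coeffA_eq[OF sq_integrable_cheb_sum] by (simp only: mult.commute)
  also have "\<dots> = (\<Sum>m\<in>I. d m * (if m = n then 1 else 0))"
    unfolding integral_mult_cheb_sum[OF sq_integrable_chebU] coeffA_chebU by simp
  also have "\<dots> = (\<Sum>m\<in>I. if m = n then d m else 0)"
    by (intro sum.cong) auto
  also have "\<dots> = (if n \<in> I then d n else 0)"
    using assms by simp
  finally show ?thesis .
qed

text \<open>Parseval for finite sums: one factor of the square takes the place of \<open>f\<close>
  in \<open>integral_mult_cheb_sum\<close>, and its coefficients are known.\<close>

lemma integral_cheb_sum_sq:
  assumes "finite I"
  shows "(LINT x|cheb_measure. (\<Sum>n\<in>I. d n * chebU n x)\<^sup>2) = pi / 2 * (\<Sum>n\<in>I. (d n)\<^sup>2)"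
  unfolding power2_eq_square integral_mult_cheb_sum[OF sq_integrable_cheb_sum]
    coeffA_cheb_sum[OF assms] by simp

text \<open>Testing against continuous functions only, this follows from the Weierstrass theorem and does
  not need completeness of the Chebyshev system.\<close>

lemma integral_mult_continuous_le:
  assumes f: "sq_integrable cheb_measure f"
    and S: "\<And>N. (\<Sum>n<N. (coeffA n f)\<^sup>2) \<le> S"
    and h: "continuous_on {-1..1} h"
  shows "(LINT x|cheb_measure. f x * h x)\<^sup>2 \<le> pi / 2 * S * (LINT x|cheb_measure. (h x)\<^sup>2)"
proof -
  have "\<exists>p. real_polynomial_function p \<and> (\<forall>x\<in>{-1..1}. \<bar>h x - p x\<bar> < 1 / real (Suc k))" for k
  proof -
    obtain q where "real_polynomial_function q" "\<And>x. x \<in> {-1..1} \<Longrightarrow> \<bar>h x - q x\<bar> < 1 / real (Suc k)"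
      by (rule Stone_Weierstrass_real_polynomial_function[OF compact_Icc h, of "1 / real (Suc k)"]) simp_all
    then show ?thesis by blast
  qed
  then have "\<exists>p. \<forall>k. real_polynomial_function (p k)
      \<and> (\<forall>x\<in>{-1..1}. \<bar>h x - p k x\<bar> < 1 / real (Suc k))"
    by (intro choice allI)
  then obtain p where p: "\<And>k. real_polynomial_function (p k)"
    "\<And>k x. x \<in> {-1..1} \<Longrightarrow> \<bar>h x - p k x\<bar> < 1 / real (Suc k)"
    by blast
  have "bounded (h ` {-1..1})"
    using h by (intro compact_imp_bounded compact_continuous_image) auto
  then obtain B where B: "\<forall>x\<in>{-1..1}. \<bar>h x\<bar> \<le> B"
    by (auto simp: bounded_iff)
  \<comment> \<open>A bound uniform in \<open>k\<close>, which supplies the dominating functions for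
    both limits below.\<close>
  have pB: "\<bar>p k x\<bar> \<le> B + 1" if "x \<in> {-1..1}" for k x
  proof -
    have "1 / real (Suc k) \<le> 1" by simp
    moreover have "\<bar>h x\<bar> \<le> B" using B that by blast
    ultimately show ?thesis using p(2)[OF that, of k] by linarith
  qed
  have "0 \<le> B" using B[rule_format, of 0] by auto
  have sqp: "sq_integrable cheb_measure (p k)" for k
    by (intro sq_integrable_cheb_continuous continuous_on_polymonial_function)
       (use p in \<open>simp add: real_polynomial_function_eq\<close>)
  have conv: "(\<lambda>k. p k x) \<longlonglongrightarrow> h x" if "x \<in> {-1..1}" for x
  proof (rule LIMSEQ_I)
    fix e :: real assume "e > 0"
    then obtain K where K: "1 / real (Suc K) < e"
      using nat_approx_posE[OF \<open>e > 0\<close>] by blast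
    have "norm (p k x - h x) < e" if "k \<ge> K" for k
    proof -
      have "1 / real (Suc k) \<le> 1 / real (Suc K)" using that by (intro divide_left_mono) auto
      with p(2)[OF \<open>x \<in> {-1..1}\<close>, of k] K show ?thesis unfolding real_norm_def by linarith
    qed
    then show "\<exists>K. \<forall>k\<ge>K. norm (p k x - h x) < e" by blast
  qed
  have [measurable]: "f \<in> borel_measurable cheb_measure" "h \<in> borel_measurable cheb_measure"
      "p k \<in> borel_measurable cheb_measure" for k
    using f sq_integrable_cheb_continuous[OF h] sqp by (auto simp: sq_integrable_def)
  have L1: "(\<lambda>k. LINT x|cheb_measure. f x * p k x) \<longlonglongrightarrow> (LINT x|cheb_measure. f x * h x)"
  proof (rule integral_dominated_convergence[where w = "\<lambda>x. (B + 1) * norm (f x)"])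
    show "integrable cheb_measure (\<lambda>x. (B + 1) * norm (f x))"
      using cheb.sq_integrable_imp_integrable[OF f] by auto
    show "AE x in cheb_measure. norm (f x * p k x) \<le> (B + 1) * norm (f x)" for k
      using pB by (intro AE_I2) (simp add: abs_mult mult.commute[of "\<bar>f _\<bar>"] mult_right_mono)
    show "AE x in cheb_measure. (\<lambda>k. f x * p k x) \<longlonglongrightarrow> f x * h x"
      using conv by (intro AE_I2 tendsto_intros) auto
  qed auto
  have L2: "(\<lambda>k. LINT x|cheb_measure. (p k x)\<^sup>2) \<longlonglongrightarrow> (LINT x|cheb_measure. (h x)\<^sup>2)"
  proof (rule integral_dominated_convergence[where w = "\<lambda>x. (B + 1)\<^sup>2"])
    have "norm ((p k x)\<^sup>2) \<le> (B + 1)\<^sup>2" if "x \<in> {-1..1}" for k x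
      using pB[OF that, of k] power_mono[of "\<bar>p k x\<bar>" "B + 1" 2] by simp
    then show "AE x in cheb_measure. norm ((p k x)\<^sup>2) \<le> (B + 1)\<^sup>2" for k
      by (intro AE_I2) auto
    show "AE x in cheb_measure. (\<lambda>k. (p k x)\<^sup>2) \<longlonglongrightarrow> (h x)\<^sup>2"
      using conv by (intro AE_I2 tendsto_intros) auto
  qed auto
  \<comment> \<open>For the finite Chebyshev combination \<open>p k\<close> both integrals are sums
    over coefficients, and the discrete Cauchy-Schwarz inequality applies.\<close>
  have "(LINT x|cheb_measure. f x * p k x)\<^sup>2 \<le> pi / 2 * S * (LINT x|cheb_measure. (p k x)\<^sup>2)" for k
  proof -
    obtain N d where pk: "p k = (\<lambda>x. \<Sum>n<N. d n * chebU n x)"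
      using cheb_span_polynomial[OF p(1)[of k]] by (auto simp: cheb_span_def)
    have "(\<Sum>n<N. d n * coeffA n f)\<^sup>2 \<le> (\<Sum>n<N. (d n)\<^sup>2) * (\<Sum>n<N. (coeffA n f)\<^sup>2)"
      by (rule Cauchy_Schwarz_ineq_sum)
    also have "\<dots> \<le> (\<Sum>n<N. (d n)\<^sup>2) * S"
      by (intro mult_left_mono S sum_nonneg) auto
    finally have "(pi / 2)\<^sup>2 * (\<Sum>n<N. d n * coeffA n f)\<^sup>2 \<le> (pi / 2)\<^sup>2 * ((\<Sum>n<N. (d n)\<^sup>2) * S)"
      by (intro mult_left_mono) auto
    then show ?thesis
      unfolding pk integral_mult_cheb_sum[OF f] integral_cheb_sum_sq[OF finite_lessThan]
      unfolding power_mult_distrib by (simp only: power2_eq_square[of "pi / 2"] ac_simps)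
  qed
  then show ?thesis
    by (intro LIMSEQ_le[OF tendsto_power[OF L1] tendsto_mult_left[OF L2]]) auto
qed

text \<open>The partial sums are Cauchy in L2 by Parseval; the coefficients are continuous in the L2
  norm and so pass to the limit.\<close>

lemma Riesz_Fischer_chebU:
  assumes "summable (\<lambda>n. (c n)\<^sup>2)" "\<And>n. odd n \<Longrightarrow> c n = 0"
  obtains f where "inH f" "\<And>n. coeffA n f = c n"
proof -
  define s where "s = (\<lambda>N x. \<Sum>n<N. c n * chebU n x)"
  have sq: "sq_integrable cheb_measure (s N)" for N
    unfolding s_def by (rule sq_integrable_cheb_sum)
  have dist: "(LINT x|cheb_measure. (s i x - s j x)\<^sup>2) = pi / 2 * (\<Sum>n\<in>{j..<i}. (c n)\<^sup>2)"
    if "j \<le> i" for i j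
  proof -
    have "s i x - s j x = (\<Sum>n\<in>{j..<i}. c n * chebU n x)" for x
      unfolding s_def lessThan_atLeast0 using sum_diff_nat_ivl[of 0 j i] that by simp
    then show ?thesis by (simp add: integral_cheb_sum_sq)
  qed
  have "\<exists>N. \<forall>i\<ge>N. \<forall>j\<ge>N. (LINT x|cheb_measure. (s i x - s j x)\<^sup>2) \<le> e" if "e > 0" for e
  proof -
    \<comment> \<open>The threshold \<open>e / 2\<close> absorbs the factor
      \<open>pi / 2 < 2\<close>.\<close>
    obtain N where N: "\<And>m n. m \<ge> N \<Longrightarrow> norm (\<Sum>n\<in>{m..<n}. (c n)\<^sup>2) < e / 2"
      using assms(1)[unfolded summable_Cauchy, rule_format, of "e / 2"] \<open>e > 0\<close> by auto
    have *: "(LINT x|cheb_measure. (s i x - s j x)\<^sup>2) \<le> e" if "j \<ge> N" "j \<le> i" for i j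
    proof -
      have "(\<Sum>n\<in>{j..<i}. (c n)\<^sup>2) \<le> e / 2"
        using N[OF \<open>j \<ge> N\<close>, of i] by simp
      then have "pi / 2 * (\<Sum>n\<in>{j..<i}. (c n)\<^sup>2) \<le> 2 * (e / 2)"
        using pi_less_4 by (intro mult_mono) (auto intro: sum_nonneg)
      then show ?thesis using dist[OF \<open>j \<le> i\<close>] by simp
    qed
    have "(LINT x|cheb_measure. (s i x - s j x)\<^sup>2) \<le> e" if "j \<ge> N" "i \<ge> N" for i j
      using *[of j i] *[of i j] that by (cases "j \<le> i") (auto simp: power2_commute[of "s i _"])
    then show ?thesis by blast
  qed
  then obtain r where r: "sq_integrable cheb_measure (\<lambda>x. lim (\<lambda>k. s (r k) x))"
    "(\<lambda>n. LINT x|cheb_measure. (s n x - lim (\<lambda>k. s (r k) x))\<^sup>2) \<longlonglongrightarrow> 0"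
    by (rule cheb.L2_complete[OF sq])
  define f where "f x = lim (\<lambda>k. s (r k) x)" for x
  note f = r[folded f_def]
  \<comment> \<open>Each partial sum is even everywhere. Hence \<open>lim\<close> is taken of the
    same sequence at \<open>x\<close> and \<open>- x\<close>, and \<open>f\<close> is even also
    where the subsequence diverges.\<close>
  have "s N (- x) = s N x" for N x
    unfolding s_def
  proof (intro sum.cong refl)
    fix n
    show "c n * chebU n (- x) = c n * chebU n x"
      using assms(2)[of n] by (cases "even n") (auto simp: chebU_minus)
  qed
  then have "f (- x) = f x" for x
    by (simp add: f_def)
  with f have "inH f" by (simp add: inH_iff)
  moreover have "coeffA n f = c n" for n
  proof -
    have "(\<lambda>N. (coeffA n (s N) - coeffA n f)\<^sup>2) \<longlonglongrightarrow> 0"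
    proof (rule tendsto_sandwich[where f = "\<lambda>_. 0"
          and h = "\<lambda>N. 2 / pi * (LINT x|cheb_measure. (s N x - f x)\<^sup>2)"])
      show "(\<lambda>N. 2 / pi * (LINT x|cheb_measure. (s N x - f x)\<^sup>2)) \<longlonglongrightarrow> 0"
        using tendsto_mult_left[OF f(2), of "2 / pi"] by simp
      \<comment> \<open>Cauchy-Schwarz against \<open>chebU n\<close>, whose squared norm is
        \<open>pi / 2\<close>; the constant is \<open>(2 / pi)^2 * (pi / 2)\<close>.\<close>
      have "(coeffA n (s N) - coeffA n f)\<^sup>2 \<le> 2 / pi * (LINT x|cheb_measure. (s N x - f x)\<^sup>2)" for N
      proof -
        note sqd = sq_integrable_diff[OF sq f(1), of N]
        have "(LINT x|cheb_measure. (s N x - f x) * chebU n x)\<^sup>2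
            \<le> (LINT x|cheb_measure. (s N x - f x)\<^sup>2) * (pi / 2)"
          using Cauchy_Schwarz_integral[OF sqd sq_integrable_chebU, of n] integral_chebU_mult[of n n]
          by (simp add: power2_eq_square)
        then have "(2 / pi)\<^sup>2 * (LINT x|cheb_measure. (s N x - f x) * chebU n x)\<^sup>2
            \<le> (2 / pi)\<^sup>2 * ((LINT x|cheb_measure. (s N x - f x)\<^sup>2) * (pi / 2))"
          by (intro mult_left_mono) auto
        then show ?thesis
          unfolding coeffA_diff[OF sq f(1), symmetric] coeffA_eq[OF sqd] power_mult_distrib
          by (simp add: power2_eq_square)
      qed
      then show "\<forall>\<^sub>F N in sequentially. (coeffA n (s N) - coeffA n f)\<^sup>2
          \<le> 2 / pi * (LINT x|cheb_measure. (s N x - f x)\<^sup>2)" by simp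
    qed auto
    \<comment> \<open>Once \<open>n < N\<close>, the coefficient of \<open>s N\<close> is exactly
      \<open>c n\<close>, which leaves a constant sequence tending to 0.\<close>
    moreover have "\<forall>\<^sub>F N in sequentially. (coeffA n (s N) - coeffA n f)\<^sup>2 = (c n - coeffA n f)\<^sup>2"
      using eventually_gt_at_top[of n]
    proof eventually_elim
      case (elim N)
      then show ?case by (simp add: s_def coeffA_cheb_sum)
    qed
    ultimately have "(\<lambda>N. (c n - coeffA n f)\<^sup>2) \<longlonglongrightarrow> 0"
      by (rule Lim_transform_eventually)
    then show ?thesis by (simp add: LIMSEQ_const_iff)
  qed
  ultimately show thesis by (rule that)
qed

section \<open>The bending moment and existence of a minimiser\<close>

text \<open>Odd coefficients vanish, and the even indices below \<open>2 * N\<close> are exactly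
  \<open>2 * m\<close> with \<open>m < N\<close>.\<close>

lemma sum_coeffA_le:
  assumes "inH f" "\<And>N. (\<Sum>m<N. (coeffA (2 * m) f)\<^sup>2) \<le> S"
  shows "(\<Sum>n<N. (coeffA n f)\<^sup>2) \<le> S"
proof -
  have "(\<Sum>n<N. (coeffA n f)\<^sup>2) \<le> (\<Sum>n<2 * N. (coeffA n f)\<^sup>2)"
    by (intro sum_mono2) auto
  also have "\<dots> = (\<Sum>n<2 * N. if even n then (coeffA n f)\<^sup>2 else 0)"
    using coeffA_odd_eq_0[OF assms(1)] by (intro sum.cong) auto
  also have "\<dots> = (\<Sum>m<N. (coeffA (2 * m) f)\<^sup>2)"
    by (subst sum_split_even_odd) simp
  finally show ?thesis using assms(2)[of N] by linarith
qed

text \<open>The kernel is extended by 0 to the left of \<open>\<xi>\<close>: it stays continuous,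
  and the domain of integration no longer depends on \<open>\<xi>\<close>.\<close>

definition bend :: "(real \<Rightarrow> real) \<Rightarrow> real \<Rightarrow> real" where
  "bend f \<xi> = (LINT \<eta>|cheb_measure. f \<eta> * max 0 (\<eta> - \<xi>))"

lemma moment_eq:
  assumes "inH f"
  shows "moment b f = ennreal (b ^ 3 / 4) * (\<integral>\<^sup>+ \<xi>\<in>{0..1}. ennreal \<bar>bend f \<xi>\<bar> \<partial>lborel)"
proof -
  have "(LBINT \<eta>:{\<xi>..1}. f \<eta> * sqrt (1 - \<eta>\<^sup>2) * (\<eta> - \<xi>)) = bend f \<xi>" if "\<xi> \<in> {0..1}" for \<xi>
  proof -
    have "f \<in> borel_measurable cheb_measure"
      using assms by (simp add: inH_iff sq_integrable_measurable)
    moreover have "(\<lambda>\<eta>. max 0 (\<eta> - \<xi>)) \<in> borel_measurable cheb_measure"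
      by (rule borel_measurable_cheb_measure) simp
    ultimately have "bend f \<xi> = (LBINT \<eta>:{-1<..<1}. (f \<eta> * max 0 (\<eta> - \<xi>)) * sqrt (1 - \<eta>\<^sup>2))"
      unfolding bend_def
      by (intro integral_cheb_measure borel_measurable_times)
    \<comment> \<open>The kernel vanishes left of \<open>\<xi>\<close>, and the weight vanishes at
      1, the only point of \<open>{\<xi>..1}\<close> outside the open interval.\<close>
    also have "\<dots> = (LBINT \<eta>:{\<xi>..1}. f \<eta> * sqrt (1 - \<eta>\<^sup>2) * (\<eta> - \<xi>))"
      unfolding set_lebesgue_integral_def
      using that by (intro Bochner_Integration.integral_cong) (auto split: split_indicator simp: max_def)
    finally show ?thesis ..
  qed
  then have "(\<integral>\<^sup>+ \<xi>\<in>{0..1}. ennreal \<bar>LBINT \<eta>:{\<xi>..1}. f \<eta> * sqrt (1 - \<eta>\<^sup>2) * (\<eta> - \<xi>)\<bar> \<partial>lborel)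
      = (\<integral>\<^sup>+ \<xi>\<in>{0..1}. ennreal \<bar>bend f \<xi>\<bar> \<partial>lborel)"
    by (intro nn_integral_cong) (simp split: split_indicator)
  then show ?thesis by (simp only: moment_def)
qed

lemma bend_measurable:
  assumes "inH f"
  shows "bend f \<in> borel_measurable borel"
proof -
  have [measurable]: "f \<in> borel_measurable cheb_measure"
    using assms by (simp add: inH_iff sq_integrable_measurable)
  have [measurable]: "(\<lambda>x. x) \<in> borel_measurable cheb_measure"
    by (intro borel_measurable_cheb_measure) auto
  show ?thesis
    unfolding bend_def by (rule cheb.borel_measurable_lebesgue_integral) measurable
qed

lemma integral_max_sq_le:
  assumes "\<xi> \<in> {0..1}"
  shows "(LINT \<eta>|cheb_measure. (max 0 (\<eta> - \<xi>))\<^sup>2) \<le> pi / 2"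
proof -
  have "(LINT \<eta>|cheb_measure. (max 0 (\<eta> - \<xi>))\<^sup>2) \<le> (LINT \<eta>|cheb_measure. 1)"
  proof (rule integral_mono)
    show "integrable cheb_measure (\<lambda>\<eta>. (max 0 (\<eta> - \<xi>))\<^sup>2)"
      by (intro sq_integrable_square sq_integrable_cheb_continuous continuous_intros)
    show "(max 0 (\<eta> - \<xi>))\<^sup>2 \<le> 1" if "\<eta> \<in> space cheb_measure" for \<eta>
      using that assms by (intro power_le_one) auto
  qed simp
  then show ?thesis by (simp add: measure_cheb_measure)
qed

text \<open>One factor \<open>pi / 2\<close> comes from \<open>integral_mult_continuous_le\<close>,
  the other bounds the squared norm of the kernel.\<close>

lemma bend_diff_sq_le:
  assumes f: "inH f" and g: "inH g" and "\<xi> \<in> {0..1}"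
    and S: "\<And>N. (\<Sum>m<N. (coeffA (2 * m) f - coeffA (2 * m) g)\<^sup>2) \<le> S"
  shows "(bend f \<xi> - bend g \<xi>)\<^sup>2 \<le> (pi / 2)\<^sup>2 * S"
proof -
  define h where "h = (\<lambda>\<eta>. max 0 (\<eta> - \<xi>))"
  have h: "continuous_on {-1..1} h" unfolding h_def by (intro continuous_intros)
  have sq: "sq_integrable cheb_measure f" "sq_integrable cheb_measure g"
    using f g by (auto simp: inH_iff)
  have "0 \<le> S" using S[of 0] by simp
  have fg: "inH (\<lambda>x. f x - g x)"
    using f g sq_integrable_diff[OF sq] by (auto simp: inH_iff)
  have "(\<Sum>n<N. (coeffA n (\<lambda>x. f x - g x))\<^sup>2) \<le> S" for N
    by (rule sum_coeffA_le[OF fg]) (use S in \<open>simp add: coeffA_diff[OF sq]\<close>)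
  then have "(LINT x|cheb_measure. (f x - g x) * h x)\<^sup>2
      \<le> pi / 2 * S * (LINT x|cheb_measure. (h x)\<^sup>2)"
    by (intro integral_mult_continuous_le h sq_integrable_diff sq)
  also have "\<dots> \<le> pi / 2 * S * (pi / 2)"
    using integral_max_sq_le[OF \<open>\<xi> \<in> {0..1}\<close>] \<open>0 \<le> S\<close> unfolding h_def
    by (intro mult_left_mono) auto
  also have "(LINT x|cheb_measure. (f x - g x) * h x) = bend f \<xi> - bend g \<xi>"
    unfolding bend_def h_def[symmetric]
    using sq_integrable_mult_integrable[OF sq(1) sq_integrable_cheb_continuous[OF h]]
      sq_integrable_mult_integrable[OF sq(2) sq_integrable_cheb_continuous[OF h]]
    by (simp add: left_diff_distrib h_def)
  finally show ?thesis by (simp only: power2_eq_square[of "pi / 2"] ac_simps)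
qed

text \<open>Trades the extended-real series for real partial sums, a form in which a bound survives
  coefficientwise limits.\<close>

lemma drag_le_iff:
  assumes "0 \<le> D"
  shows "drag f \<le> ennreal D
    \<longleftrightarrow> (\<forall>N. (\<Sum>m<N. real (2 * m + 1) * (coeffA (2 * m) f)\<^sup>2) \<le> 8 / pi * D)"
proof -
  define w where "w = (\<lambda>m. real (2 * m + 1) * (coeffA (2 * m) f)\<^sup>2)"
  have w: "0 \<le> w m" for m by (simp add: w_def)
  have part: "(\<Sum>m<N. ennreal (pi / 8) * ennreal (w m)) = ennreal (pi / 8 * (\<Sum>m<N. w m))" for N
    using w by (simp add: sum_ennreal sum_distrib_left ennreal_mult[symmetric])
  have "drag f = (\<Sum>m. ennreal (pi / 8) * ennreal (w m))"
    by (simp add: drag_def w_def)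
  also have "\<dots> = (SUP N. ennreal (pi / 8 * (\<Sum>m<N. w m)))"
    unfolding suminf_eq_SUP part ..
  finally have "drag f \<le> ennreal D \<longleftrightarrow> (\<forall>N. ennreal (pi / 8 * (\<Sum>m<N. w m)) \<le> ennreal D)"
    by (simp add: SUP_le_iff)
  also have "\<dots> \<longleftrightarrow> (\<forall>N. (\<Sum>m<N. w m) \<le> 8 / pi * D)"
    using assms by (simp add: field_simps)
  finally show ?thesis by (simp add: w_def)
qed

section \<open>Compactness of coefficient sequences\<close>

lemma bounded_family_convergent_subseq:
  fixes a :: "nat \<Rightarrow> nat \<Rightarrow> real"
  assumes "\<And>k n. \<bar>a k n\<bar> \<le> C"
  obtains r c where "strict_mono r" "\<And>n. (\<lambda>k. a (r k) n) \<longlonglongrightarrow> c n"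
proof -
  \<comment> \<open>By Tychonoff this cube is compact; a countable product of lines is first
    countable, so compactness yields a convergent subsequence, and the coordinate projections are
    continuous.\<close>
  define K :: "(nat \<Rightarrow> real) set" where "K = (\<Pi>\<^sub>E n\<in>UNIV. {-C..C})"
  have "compactin (product_topology (\<lambda>n. euclidean) UNIV) K"
    unfolding K_def compactin_PiE by simp
  then have "compact K"
    by (simp add: euclidean_product_topology)
  then have "seq_compact K" by (rule compact_imp_seq_compact)
  moreover have "\<forall>k. a k \<in> K"
    using assms by (auto simp: K_def abs_le_iff minus_le_iff)
  ultimately obtain c r where r: "strict_mono r" "(a \<circ> r) \<longlonglongrightarrow> c"
    by (rule seq_compactE)
  have "(\<lambda>k. (a \<circ> r) k n) \<longlonglongrightarrow> c n" for n
    using continuous_on_tendsto_compose[OF continuous_on_product_coordinates r(2)] by auto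
  with r(1) show thesis by (intro that[of r c]) auto
qed

text \<open>The weights \<open>2 m + 1\<close> make the tails uniformly small, so coordinatewise convergence improves to
  convergence in \<open>\<ell>\<^sup>2\<close>.\<close>

lemma weighted_l2_bounded_tendsto:
  fixes a :: "nat \<Rightarrow> nat \<Rightarrow> real"
  assumes lim: "\<And>m. (\<lambda>k. a k m) \<longlonglongrightarrow> c m"
    and a: "\<And>k N. (\<Sum>m<N. real (2 * m + 1) * (a k m)\<^sup>2) \<le> B"
    and c: "\<And>N. (\<Sum>m<N. real (2 * m + 1) * (c m)\<^sup>2) \<le> B"
    and "0 < e"
  shows "\<forall>\<^sub>F k in sequentially. \<forall>L. (\<Sum>m<L. (a k m - c m)\<^sup>2) \<le> e"
proof -
  have "0 \<le> B" using c[of 0] by simp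
  \<comment> \<open>Makes the tail bound \<open>4 * B / (2 * N + 1)\<close> derived below at most
    \<open>e / 2\<close>, independently of \<open>k\<close> and \<open>L\<close>.\<close>
  obtain N :: nat where N: "8 * B / e < real N"
    using reals_Archimedean2 by blast
  have "(\<lambda>k. \<Sum>m<N. (a k m - c m)\<^sup>2) \<longlonglongrightarrow> (\<Sum>m<N. (c m - c m)\<^sup>2)"
    by (intro tendsto_intros lim)
  then have "\<forall>\<^sub>F k in sequentially. (\<Sum>m<N. (a k m - c m)\<^sup>2) < e / 2"
    using \<open>0 < e\<close> by (intro order_tendstoD(2)) auto
  then show ?thesis
  proof eventually_elim
    case (elim k)
    show ?case
    proof
      fix L
      \<comment> \<open>On the tail the weight is at least \<open>2 * N + 1\<close>, and
        \<open>(x - y)^2\<close> is at most \<open>2 x^2 + 2 y^2\<close>.\<close>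
      have "(\<Sum>m\<in>{N..<L}. (a k m - c m)\<^sup>2) * real (2 * N + 1)
          \<le> (\<Sum>m\<in>{N..<L}. real (2 * m + 1) * (2 * (a k m)\<^sup>2 + 2 * (c m)\<^sup>2))"
        unfolding sum_distrib_right
      proof (intro sum_mono)
        fix m assume m: "m \<in> {N..<L}"
        have "(a k m - c m)\<^sup>2 \<le> 2 * (a k m)\<^sup>2 + 2 * (c m)\<^sup>2"
          using sum_squares_bound[of "a k m" "- c m"] by (simp add: power2_diff)
        then have "(a k m - c m)\<^sup>2 * real (2 * N + 1)
            \<le> (2 * (a k m)\<^sup>2 + 2 * (c m)\<^sup>2) * real (2 * m + 1)"
          using m by (intro mult_mono) auto
        then show "(a k m - c m)\<^sup>2 * real (2 * N + 1)
            \<le> real (2 * m + 1) * (2 * (a k m)\<^sup>2 + 2 * (c m)\<^sup>2)"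
          by (simp add: mult.commute)
      qed
      also have "\<dots> \<le> (\<Sum>m<L. real (2 * m + 1) * (2 * (a k m)\<^sup>2 + 2 * (c m)\<^sup>2))"
        by (intro sum_mono2) auto
      also have "\<dots> = 2 * (\<Sum>m<L. real (2 * m + 1) * (a k m)\<^sup>2)
          + 2 * (\<Sum>m<L. real (2 * m + 1) * (c m)\<^sup>2)"
        by (simp only: distrib_left sum.distrib sum_distrib_left mult.left_commute)
      also have "\<dots> \<le> 4 * B"
        using a[of k L] c[of L] by linarith
      also have "\<dots> \<le> e / 2 * real (2 * N + 1)"
      proof -
        have "8 * B \<le> real N * e" using N \<open>0 < e\<close> by (simp add: field_simps)
        also have "\<dots> \<le> e * real (2 * N + 1)" using \<open>0 < e\<close> by (simp add: algebra_simps)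
        finally show ?thesis by simp
      qed
      finally have tail: "(\<Sum>m\<in>{N..<L}. (a k m - c m)\<^sup>2) \<le> e / 2"
        by (rule mult_right_le_imp_le) simp
      \<comment> \<open>The union contains \<open>{..<L}\<close> also when
        \<open>L < N\<close>.\<close>
      have "(\<Sum>m<L. (a k m - c m)\<^sup>2) \<le> (\<Sum>m\<in>{..<N} \<union> {N..<L}. (a k m - c m)\<^sup>2)"
        by (intro sum_mono2) auto
      also have "\<dots> = (\<Sum>m<N. (a k m - c m)\<^sup>2) + (\<Sum>m\<in>{N..<L}. (a k m - c m)\<^sup>2)"
        by (intro sum.union_disjoint) auto
      finally show "(\<Sum>m<L. (a k m - c m)\<^sup>2) \<le> e"
        using elim tail by linarith
    qed
  qed
qed

section \<open>Existence of a minimiser\<close>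

lemma admissible1_nonempty:
  assumes "0 < b0"
  shows "\<exists>b f. (b, f) \<in> admissible1 b0"
proof -
  \<comment> \<open>For the constant \<open>f\<close> below the moment is at most
    \<open>b^3 / 4 * (2 / b) = b^2 / 2\<close>, so capping the span at 1 secures the
    constraint.\<close>
  define b where "b = min b0 1"
  have b: "0 < b" "b \<le> b0" "b \<le> 1" using assms by (auto simp: b_def)
  \<comment> \<open>The constant is dictated by the lift constraint; as a one-term Chebyshev sum it
    has known coefficients.\<close>
  define f :: "real \<Rightarrow> real" where "f = (\<lambda>x. \<Sum>n\<in>{0}. 4 / (pi * b) * chebU n x)"
  have f_const: "f x = 4 / (pi * b)" for x by (simp add: f_def)
  have coeff: "coeffA n f = (if n = 0 then 4 / (pi * b) else 0)" for n
    unfolding f_def by (subst coeffA_cheb_sum) auto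
  have "sq_integrable cheb_measure f"
    unfolding f_def by (rule sq_integrable_cheb_sum)
  then have "inH f"
    by (simp add: inH_iff f_const)
  have "drag f \<le> ennreal (pi / 8 * (4 / (pi * b))\<^sup>2)"
  proof (subst drag_le_iff)
    have "(\<Sum>m<N. real (2 * m + 1) * (coeffA (2 * m) f)\<^sup>2)
        = (\<Sum>m<N. if m = 0 then (4 / (pi * b))\<^sup>2 else 0)" for N
      by (intro sum.cong) (auto simp: coeff)
    then show "\<forall>N. (\<Sum>m<N. real (2 * m + 1) * (coeffA (2 * m) f)\<^sup>2)
        \<le> 8 / pi * (pi / 8 * (4 / (pi * b))\<^sup>2)"
      by simp
  qed simp
  then have "drag f < \<infinity>" by (rule le_less_trans) simp
  have "\<bar>bend f \<xi>\<bar> \<le> 2 / b" if "\<xi> \<in> {0..1}" for \<xi>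
  proof -
    have "0 \<le> (LINT \<eta>|cheb_measure. max 0 (\<eta> - \<xi>))" by simp
    moreover have "(LINT \<eta>|cheb_measure. max 0 (\<eta> - \<xi>)) \<le> (LINT \<eta>|cheb_measure. 1)"
    proof (rule integral_mono)
      show "integrable cheb_measure (\<lambda>\<eta>. max 0 (\<eta> - \<xi>))"
        by (intro cheb.sq_integrable_imp_integrable sq_integrable_cheb_continuous continuous_intros)
    qed (use that in auto)
    ultimately have "\<bar>LINT \<eta>|cheb_measure. max 0 (\<eta> - \<xi>)\<bar> \<le> pi / 2"
      by (simp add: measure_cheb_measure)
    then have "4 / (pi * b) * \<bar>LINT \<eta>|cheb_measure. max 0 (\<eta> - \<xi>)\<bar> \<le> 4 / (pi * b) * (pi / 2)"
      using b by (intro mult_left_mono) auto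
    then show ?thesis
      using b by (simp add: bend_def f_const abs_mult)
  qed
  then have "(\<integral>\<^sup>+ \<xi>\<in>{0..1}. ennreal \<bar>bend f \<xi>\<bar> \<partial>lborel)
      \<le> (\<integral>\<^sup>+ \<xi>. ennreal (2 / b) * indicator {0..1::real} \<xi> \<partial>lborel)"
    by (intro nn_integral_mono) (auto split: split_indicator intro: ennreal_leI)
  also have "\<dots> = ennreal (2 / b)"
    by (subst nn_integral_cmult_indicator) auto
  finally have "moment b f \<le> ennreal (b ^ 3 / 4) * ennreal (2 / b)"
    unfolding moment_eq[OF \<open>inH f\<close>] by (intro mult_left_mono) auto
  also have "\<dots> = ennreal (b\<^sup>2 / 2)"
    using b by (simp add: ennreal_mult[symmetric] power2_eq_square power3_eq_cube)
  also have "\<dots> \<le> 1"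
    using b power_le_one[of b 2] by (simp add: ennreal_le_1)
  finally have "moment b f \<le> 1" .
  with b \<open>inH f\<close> \<open>drag f < \<infinity>\<close> coeff show ?thesis
    unfolding admissible1_def by (intro exI[of _ b] exI[of _ f]) simp
qed

theorem theorem3p1:
  fixes b0 :: real
  assumes "0 < b0"
  shows "\<exists>bt ft. (bt, ft) \<in> admissible1 b0 \<and>
           (\<forall>b f. (b, f) \<in> admissible1 b0 \<longrightarrow> drag ft \<le> drag f)"
proof -
  define I where "I = Inf {drag f | b f. (b, f) \<in> admissible1 b0}"
  obtain b1 f1 where 1: "(b1, f1) \<in> admissible1 b0"
    using admissible1_nonempty[OF assms] by blast
  \<comment> \<open>Any admissible pair shows that the infimum is finite, hence a real number
    \<open>D\<close> from which a minimising sequence can be measured.\<close>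
  have "I \<le> drag f1" unfolding I_def using 1 by (intro Inf_lower) auto
  also have "drag f1 < \<infinity>" using 1 by (auto simp: admissible1_def)
  finally obtain D where D: "I = ennreal D" "0 \<le> D"
    by (cases I) auto
  have "\<exists>z. (fst z, snd z) \<in> admissible1 b0 \<and> drag (snd z) \<le> ennreal (D + 1 / real (Suc k))" for k
  proof -
    have "I < ennreal (D + 1 / real (Suc k))"
      unfolding D using D(2) by (intro ennreal_lessI) (auto intro: add_nonneg_pos)
    then show ?thesis
      unfolding I_def Inf_less_iff by (auto intro: less_imp_le)
  qed
  then have "\<exists>z. \<forall>k. (fst (z k), snd (z k)) \<in> admissible1 b0
      \<and> drag (snd (z k)) \<le> ennreal (D + 1 / real (Suc k))"
    by (intro choice allI)
  then obtain z where z: "\<And>k. (fst (z k), snd (z k)) \<in> admissible1 b0"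
    "\<And>k. drag (snd (z k)) \<le> ennreal (D + 1 / real (Suc k))" by blast
  define b where "b = (\<lambda>k. fst (z k))"
  define f where "f = (\<lambda>k. snd (z k))"
  have adm: "0 < b k" "b k \<le> b0" "inH (f k)" "coeffA 0 (f k) = 4 / (pi * b k)"
      "moment (b k) (f k) \<le> 1" for k
    using z(1)[of k] by (auto simp: admissible1_def b_def f_def)
  define a where "a = (\<lambda>k m. coeffA (2 * m) (f k))"
  have a_bound: "(\<Sum>m<N. real (2 * m + 1) * (a k m)\<^sup>2) \<le> 8 / pi * (D + 1 / real (Suc k))" for k N
  proof -
    have "0 \<le> D + 1 / real (Suc k)" using D(2) by simp
    from z(2)[of k, unfolded drag_le_iff[OF this]] show ?thesis by (simp only: a_def f_def)
  qed
  define B where "B = 8 / pi * (D + 1)"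
  have a_B: "(\<Sum>m<N. real (2 * m + 1) * (a k m)\<^sup>2) \<le> B" for k N
  proof -
    have "8 / pi * (D + 1 / real (Suc k)) \<le> B"
      unfolding B_def by (intro mult_left_mono add_left_mono) auto
    with a_bound[of k N] show ?thesis by linarith
  qed
  \<comment> \<open>The weights are at least 1, so \<open>B\<close> bounds each square, and
    \<open>2 x \<le> x^2 + 1\<close> passes to the absolute value.\<close>
  have "\<bar>a k m\<bar> \<le> B + 1" for k m
  proof -
    have "(a k m)\<^sup>2 \<le> real (2 * m + 1) * (a k m)\<^sup>2"
      using mult_right_mono[of 1 "real (2 * m + 1)" "(a k m)\<^sup>2"] by simp
    also have "\<dots> \<le> (\<Sum>m<Suc m. real (2 * m + 1) * (a k m)\<^sup>2)"
      by (rule member_le_sum) auto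
    also have "\<dots> \<le> B" by (rule a_B)
    finally have "\<bar>a k m\<bar>\<^sup>2 \<le> B" by simp
    moreover have "2 * \<bar>a k m\<bar> \<le> \<bar>a k m\<bar>\<^sup>2 + 1"
      using sum_squares_bound[of "\<bar>a k m\<bar>" 1] by simp
    ultimately show ?thesis by linarith
  qed
  then obtain r c where r: "strict_mono r" and lim: "\<And>m. (\<lambda>k. a (r k) m) \<longlonglongrightarrow> c m"
    using bounded_family_convergent_subseq[of a "B + 1"] by blast
  \<comment> \<open>Lower semicontinuity of the drag: the limit is taken in each partial sum, with
    the sharp constant \<open>D\<close> in place of the crude \<open>B\<close>.\<close>
  have c_bound: "(\<Sum>m<N. real (2 * m + 1) * (c m)\<^sup>2) \<le> 8 / pi * D" for N
  proof (rule LIMSEQ_le)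
    show "(\<lambda>k. \<Sum>m<N. real (2 * m + 1) * (a (r k) m)\<^sup>2)
        \<longlonglongrightarrow> (\<Sum>m<N. real (2 * m + 1) * (c m)\<^sup>2)"
      by (intro tendsto_intros lim)
    have "(\<lambda>k. 8 / pi * (D + 1 / real (Suc (r k)))) \<longlonglongrightarrow> 8 / pi * (D + 0)"
      by (intro tendsto_intros LIMSEQ_subseq_LIMSEQ[OF LIMSEQ_inverse_real_of_nat r,
          unfolded o_def inverse_eq_divide])
    then show "(\<lambda>k. 8 / pi * (D + 1 / real (Suc (r k)))) \<longlonglongrightarrow> 8 / pi * D" by simp
  qed (use a_bound in blast)
  have c_B: "(\<Sum>m<N. real (2 * m + 1) * (c m)\<^sup>2) \<le> B" for N
  proof -
    have "8 / pi * D \<le> B" unfolding B_def by (intro mult_left_mono) auto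
    with c_bound[of N] show ?thesis by linarith
  qed

  \<comment> \<open>The limits are placed at the even indices, with zeros at the odd ones, as an
    even function requires.\<close>
  define c' where "c' = (\<lambda>n. if even n then c (n div 2) else 0)"
  have "summable (\<lambda>n. (c' n)\<^sup>2)"
  proof (rule summableI_nonneg_bounded)
    fix N
    have "(\<Sum>n<N. (c' n)\<^sup>2) \<le> (\<Sum>n<2 * N. (c' n)\<^sup>2)"
      by (intro sum_mono2) auto
    also have "\<dots> = (\<Sum>n<2 * N. if even n then (c (n div 2))\<^sup>2 else 0)"
      by (intro sum.cong) (auto simp: c'_def)
    also have "\<dots> = (\<Sum>m<N. 1 * (c m)\<^sup>2)"
      by (subst sum_split_even_odd) simp
    also have "\<dots> \<le> (\<Sum>m<N. real (2 * m + 1) * (c m)\<^sup>2)"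
      by (intro sum_mono mult_right_mono) auto
    also have "\<dots> \<le> B" by (rule c_B)
    finally show "(\<Sum>n<N. (c' n)\<^sup>2) \<le> B" .
  qed simp
  then obtain ft where ft: "inH ft" "\<And>n. coeffA n ft = c' n"
    by (rule Riesz_Fischer_chebU) (auto simp: c'_def)
  have ft_even: "coeffA (2 * m) ft = c m" for m
    by (simp add: ft c'_def)

  have a0: "4 / (pi * b0) \<le> a k 0" for k
    using adm[of k] assms by (auto simp: a_def intro!: divide_left_mono mult_left_mono)
  have c0: "4 / (pi * b0) \<le> c 0"
    by (rule LIMSEQ_le_const[OF lim]) (use a0 in blast)
  moreover have "0 < 4 / (pi * b0)" using assms by simp
  ultimately have c0_pos: "0 < c 0" by linarith
  \<comment> \<open>The lift constraint solved for the span; \<open>c 0 > 0\<close> also makes this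
    expression continuous along the sequence.\<close>
  define bt where "bt = 4 / (pi * c 0)"
  have bt: "0 < bt" "bt \<le> b0" "coeffA 0 ft = 4 / (pi * bt)"
    using c0 c0_pos assms ft_even[of 0] by (auto simp: bt_def field_simps)
  have "b k = 4 / (pi * a k 0)" for k
    using adm[of k] by (simp add: a_def)
  then have b_lim: "(\<lambda>k. b (r k)) \<longlonglongrightarrow> bt"
    unfolding bt_def using c0_pos by (auto intro!: tendsto_intros lim)

  have drag: "drag ft \<le> I"
    unfolding D drag_le_iff[OF D(2)] ft_even using c_bound by blast

  have bend_lim: "(\<lambda>k. bend (f (r k)) \<xi>) \<longlonglongrightarrow> bend ft \<xi>" if \<xi>: "\<xi> \<in> {0..1}" for \<xi>
  proof (rule LIMSEQ_I)
    fix e :: real assume "0 < e"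
    \<comment> \<open>Chosen so that \<open>(pi / 2)^2 * d = (e / 2)^2\<close> in the moment
      estimate.\<close>
    define d where "d = (e / pi)\<^sup>2"
    have "0 < d" using \<open>0 < e\<close> by (simp add: d_def)
    from weighted_l2_bounded_tendsto[OF lim a_B c_B this]
    obtain K where K: "\<And>k L. k \<ge> K \<Longrightarrow> (\<Sum>m<L. (a (r k) m - c m)\<^sup>2) \<le> d"
      unfolding eventually_sequentially by blast
    have "norm (bend (f (r k)) \<xi> - bend ft \<xi>) < e" if "k \<ge> K" for k
    proof -
      have "(bend (f (r k)) \<xi> - bend ft \<xi>)\<^sup>2 \<le> (pi / 2)\<^sup>2 * d"
        using K[OF that] by (intro bend_diff_sq_le adm ft \<xi>) (simp add: ft_even a_def)
      also have "\<dots> = (e / 2)\<^sup>2"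
        by (simp add: d_def power_divide)
      also have "\<dots> < e\<^sup>2"
        using \<open>0 < e\<close> by (intro power_strict_mono) auto
      finally show ?thesis
        using \<open>0 < e\<close> power2_less_imp_less[of "\<bar>bend (f (r k)) \<xi> - bend ft \<xi>\<bar>" e] by simp
    qed
    then show "\<exists>K. \<forall>k\<ge>K. norm (bend (f (r k)) \<xi> - bend ft \<xi>) < e" by blast
  qed

  \<comment> \<open>The span-dependent factor is moved to the right-hand side, so that Fatou's lemma
    concerns the integral alone.\<close>
  have int_le: "(\<integral>\<^sup>+ \<xi>\<in>{0..1}. ennreal \<bar>bend (f k) \<xi>\<bar> \<partial>lborel) \<le> ennreal (4 / b k ^ 3)" for k
  proof -
    define J where "J = (\<integral>\<^sup>+ \<xi>\<in>{0..1}. ennreal \<bar>bend (f k) \<xi>\<bar> \<partial>lborel)"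
    have "ennreal (b k ^ 3 / 4) * J \<le> 1"
      using adm(5)[of k] by (simp add: moment_eq[OF adm(3)] J_def)
    then have "ennreal (4 / b k ^ 3) * (ennreal (b k ^ 3 / 4) * J) \<le> ennreal (4 / b k ^ 3) * 1"
      by (intro mult_left_mono) auto
    moreover have "ennreal (4 / b k ^ 3) * ennreal (b k ^ 3 / 4) = 1"
      using adm(1)[of k] by (simp add: ennreal_mult[symmetric])
    ultimately show ?thesis by (simp add: J_def mult.assoc[symmetric])
  qed
  have [measurable]: "bend (f k) \<in> borel_measurable borel" for k
    by (intro bend_measurable adm)
  have "(\<integral>\<^sup>+ \<xi>\<in>{0..1}. ennreal \<bar>bend ft \<xi>\<bar> \<partial>lborel)
      = (\<integral>\<^sup>+ \<xi>. liminf (\<lambda>k. ennreal \<bar>bend (f (r k)) \<xi>\<bar> * indicator {0..1} \<xi>) \<partial>lborel)"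
  proof (rule nn_integral_cong)
    fix \<xi> :: real
    have "(\<lambda>k. ennreal \<bar>bend (f (r k)) \<xi>\<bar> * indicator {0..1} \<xi>)
        \<longlonglongrightarrow> ennreal \<bar>bend ft \<xi>\<bar> * indicator {0..1} \<xi>"
      using bend_lim[of \<xi>] by (auto split: split_indicator intro!: tendsto_ennrealI tendsto_rabs)
    then show "ennreal \<bar>bend ft \<xi>\<bar> * indicator {0..1} \<xi>
        = liminf (\<lambda>k. ennreal \<bar>bend (f (r k)) \<xi>\<bar> * indicator {0..1} \<xi>)"
      by (rule lim_imp_Liminf[OF sequentially_bot, symmetric])
  qed
  also have "\<dots> \<le> liminf (\<lambda>k. \<integral>\<^sup>+ \<xi>\<in>{0..1}. ennreal \<bar>bend (f (r k)) \<xi>\<bar> \<partial>lborel)"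
    by (rule nn_integral_liminf) auto
  also have "\<dots> \<le> liminf (\<lambda>k. ennreal (4 / b (r k) ^ 3))"
    using int_le by (intro Liminf_mono) auto
  \<comment> \<open>The spans converge to the positive limit \<open>bt\<close>, so the bounds
    converge too; the factor \<open>bt^3 / 4\<close> then restores the bound 1.\<close>
  also have "\<dots> = ennreal (4 / bt ^ 3)"
    using bt(1) by (intro lim_imp_Liminf tendsto_ennrealI tendsto_intros b_lim) auto
  finally have "moment bt ft \<le> ennreal (bt ^ 3 / 4) * ennreal (4 / bt ^ 3)"
    unfolding moment_eq[OF ft(1)] by (intro mult_left_mono) auto
  also have "\<dots> = 1"
    using bt(1) by (simp add: ennreal_mult[symmetric])
  finally have "moment bt ft \<le> 1" .
  moreover have "drag ft < \<infinity>"
    using drag D(1) by (auto intro: le_less_trans)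
  ultimately have "(bt, ft) \<in> admissible1 b0"
    using bt ft(1) by (simp add: admissible1_def)
  moreover have "drag ft \<le> drag f" if "(b, f) \<in> admissible1 b0" for b f
  proof -
    have "I \<le> drag f" unfolding I_def using that by (intro Inf_lower) auto
    with drag show ?thesis by (rule order_trans)
  qed
  ultimately show ?thesis by blast
qed

end
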